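(* Let $A$ be an algebra over the commutative ring $D$. The algebra $A\otimes A$, whose product is defined according to the rule $$(a\otimes b)\circ(c\otimes d)=(ac)\otimes(db),$$ forms a representation in the module $\mathcal{L}(A;A)$. This representation allows us to identify a tensor $d\in A\otimes A$ and the transformation $d\circ\delta$, where $\delta$ is the identity transformation.
   Context: An algebra over a commutative ring $D$ is a $D$-module with a product given by a bilinear mapping $A\times A\to A$. $A\otimes A$ is the tensor product over $D$. $\mathcal{L}(A;A)$ is the $D$-module of $D$-linear mappings $A\to A$. The representation in question lets $A\otimes A$ act on $\mathcal{L}(A;A)$ by $(a\otimes b)\circ f=afb$, that is, $((a\otimes b)\circ f)\circ x=a\,(f\circ x)\,b$, extended linearly to all tensors; here $f\circ x=f(x)$. A representation assigns to each element $d\in A\otimes A$ a linear transformation $f\mapsto d\circ f$ of the module $\mathcal{L}(A;A)$, compatibly with the operations of $A\otimes A$. In particular $(a\otimes b)\circ\delta$ is the transformation $x\mapsto axb$ of $A$, and the identification means writing $(a\otimes b)\circ x$ for $((a\otimes b)\circ\delta)\circ x=axb$. The result belongs to the paper's discussion of linear mappings into associative algebras, although its wording says only "algebra". *)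

theory Defs
  imports "HOL-Algebra.Module" "HOL-Algebra.AbelCoset"
begin

section \<open>Algebras over a commutative ring\<close>

text \<open>
  The library locale \<open>algebra\<close> requires the product to be commutative and unital. Here the product
  is just bilinear; the record field \<open>one\<close> of an algebra is ignored.
\<close>

locale bilinear_algebra = module D A for D (structure) and A (structure) +
  assumes prod_closed:
      "\<lbrakk>x \<in> carrier A; y \<in> carrier A\<rbrakk> \<Longrightarrow> x \<otimes>\<^bsub>A\<^esub> y \<in> carrier A"
    and prod_add_left:
      "\<lbrakk>x \<in> carrier A; y \<in> carrier A; z \<in> carrier A\<rbrakk>
        \<Longrightarrow> (x \<oplus>\<^bsub>A\<^esub> y) \<otimes>\<^bsub>A\<^esub> z = x \<otimes>\<^bsub>A\<^esub> z \<oplus>\<^bsub>A\<^esub> y \<otimes>\<^bsub>A\<^esub> z"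
    and prod_add_right:
      "\<lbrakk>x \<in> carrier A; y \<in> carrier A; z \<in> carrier A\<rbrakk>
        \<Longrightarrow> x \<otimes>\<^bsub>A\<^esub> (y \<oplus>\<^bsub>A\<^esub> z) = x \<otimes>\<^bsub>A\<^esub> y \<oplus>\<^bsub>A\<^esub> x \<otimes>\<^bsub>A\<^esub> z"
    and prod_smult_left:
      "\<lbrakk>r \<in> carrier D; x \<in> carrier A; y \<in> carrier A\<rbrakk>
        \<Longrightarrow> (r \<odot>\<^bsub>A\<^esub> x) \<otimes>\<^bsub>A\<^esub> y = r \<odot>\<^bsub>A\<^esub> (x \<otimes>\<^bsub>A\<^esub> y)"
    and prod_smult_right:
      "\<lbrakk>r \<in> carrier D; x \<in> carrier A; y \<in> carrier A\<rbrakk>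
        \<Longrightarrow> x \<otimes>\<^bsub>A\<^esub> (r \<odot>\<^bsub>A\<^esub> y) = r \<odot>\<^bsub>A\<^esub> (x \<otimes>\<^bsub>A\<^esub> y)"

locale associative_algebra = bilinear_algebra D A for D (structure) and A (structure) +
  assumes prod_assoc:
      "\<lbrakk>x \<in> carrier A; y \<in> carrier A; z \<in> carrier A\<rbrakk>
        \<Longrightarrow> (x \<otimes>\<^bsub>A\<^esub> y) \<otimes>\<^bsub>A\<^esub> z = x \<otimes>\<^bsub>A\<^esub> (y \<otimes>\<^bsub>A\<^esub> z)"

section \<open>Linear mappings and representations\<close>

text \<open>
  Maps are taken extensional, i.e. \<open>undefined\<close> outside the carrier, so that equality in HOL is
  equality of maps on the carrier.
\<close>

definition linear_maps ::
    "('d, 'e) ring_scheme \<Rightarrow> ('d, 'a, 'm) module_scheme \<Rightarrow> ('d, 'b, 'n) module_scheme \<Rightarrow> ('a \<Rightarrow> 'b) set"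
  where "linear_maps D M N =
    {f \<in> carrier M \<rightarrow>\<^sub>E carrier N.
      (\<forall>x\<in>carrier M. \<forall>y\<in>carrier M. f (x \<oplus>\<^bsub>M\<^esub> y) = f x \<oplus>\<^bsub>N\<^esub> f y) \<and>
      (\<forall>r\<in>carrier D. \<forall>x\<in>carrier M. f (r \<odot>\<^bsub>M\<^esub> x) = r \<odot>\<^bsub>N\<^esub> f x)}"

definition identity_map :: "('d, 'a, 'm) module_scheme \<Rightarrow> 'a \<Rightarrow> 'a"
  where "identity_map M = (\<lambda>x\<in>carrier M. x)"

text \<open>The module of linear maps from \<open>M\<close> to itself, with composition as product.\<close>

definition linear_end ::
    "('d, 'e) ring_scheme \<Rightarrow> ('d, 'a, 'm) module_scheme \<Rightarrow> ('d, 'a \<Rightarrow> 'a) module"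
  where "linear_end D M =
    \<lparr>carrier = linear_maps D M M,
     mult = (\<lambda>f g. compose (carrier M) f g),
     one = identity_map M,
     zero = (\<lambda>x\<in>carrier M. \<zero>\<^bsub>M\<^esub>),
     add = (\<lambda>f g. \<lambda>x\<in>carrier M. f x \<oplus>\<^bsub>M\<^esub> g x),
     smult = (\<lambda>r f. \<lambda>x\<in>carrier M. r \<odot>\<^bsub>M\<^esub> f x)\<rparr>"

locale algebra_hom = S: bilinear_algebra D S + T: bilinear_algebra D T
  for D (structure) and S (structure) and T (structure) +
  fixes h
  assumes hom_closed: "x \<in> carrier S \<Longrightarrow> h x \<in> carrier T"
    and hom_add:
      "\<lbrakk>x \<in> carrier S; y \<in> carrier S\<rbrakk> \<Longrightarrow> h (x \<oplus>\<^bsub>S\<^esub> y) = h x \<oplus>\<^bsub>T\<^esub> h y"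
    and hom_smult:
      "\<lbrakk>r \<in> carrier D; x \<in> carrier S\<rbrakk> \<Longrightarrow> h (r \<odot>\<^bsub>S\<^esub> x) = r \<odot>\<^bsub>T\<^esub> h x"
    and hom_prod:
      "\<lbrakk>x \<in> carrier S; y \<in> carrier S\<rbrakk> \<Longrightarrow> h (x \<otimes>\<^bsub>S\<^esub> y) = h x \<otimes>\<^bsub>T\<^esub> h y"

locale algebra_representation = module D M + algebra_hom D S "linear_end D M" \<rho>
  for D (structure) and S (structure) and M (structure) and \<rho>

section \<open>Tensor products\<close>

text \<open>The free module on a set \<open>X\<close>; the fields \<open>mult\<close> and \<open>one\<close> play no role.\<close>

definition free_module :: "('d, 'e) ring_scheme \<Rightarrow> 'x set \<Rightarrow> ('d, 'x \<Rightarrow> 'd) module"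
  where "free_module D X =
    \<lparr>carrier = {u. (\<forall>p. u p \<in> carrier D) \<and> (\<forall>p. p \<notin> X \<longrightarrow> u p = \<zero>\<^bsub>D\<^esub>) \<and> finite {p. u p \<noteq> \<zero>\<^bsub>D\<^esub>}},
     mult = undefined,
     one = undefined,
     zero = (\<lambda>p. \<zero>\<^bsub>D\<^esub>),
     add = (\<lambda>u v p. u p \<oplus>\<^bsub>D\<^esub> v p),
     smult = (\<lambda>r u p. r \<otimes>\<^bsub>D\<^esub> u p)\<rparr>"

definition free_gen :: "('d, 'e) ring_scheme \<Rightarrow> 'x \<Rightarrow> 'x \<Rightarrow> 'd"
  where "free_gen D p = (\<lambda>q. if q = p then \<one>\<^bsub>D\<^esub> else \<zero>\<^bsub>D\<^esub>)"

definition span_submodule :: "('d, 'e) ring_scheme \<Rightarrow> ('d, 'a, 'm) module_scheme \<Rightarrow> 'a set \<Rightarrow> 'a set"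
  where "span_submodule D M X = \<Inter>{N. submodule N D M \<and> X \<subseteq> N}"

definition quotient_module ::
    "('d, 'a, 'm) module_scheme \<Rightarrow> 'a set \<Rightarrow> ('d, 'a set) module"
  where "quotient_module M N =
    \<lparr>carrier = a_rcosets\<^bsub>M\<^esub> N,
     mult = undefined,
     one = undefined,
     zero = N,
     add = (<+>\<^bsub>M\<^esub>),
     smult = (\<lambda>r U. \<Union>u\<in>U. N +>\<^bsub>M\<^esub> (r \<odot>\<^bsub>M\<^esub> u))\<rparr>"

definition tensor_relations ::
    "('d, 'e) ring_scheme \<Rightarrow> ('d, 'a, 'm) module_scheme \<Rightarrow> ('d, 'b, 'n) module_scheme
      \<Rightarrow> ('a \<times> 'b \<Rightarrow> 'd) set"
  where "tensor_relations D M N = (let F = free_module D (carrier M \<times> carrier N); g = free_gen D in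
    {g (x \<oplus>\<^bsub>M\<^esub> x', y) \<ominus>\<^bsub>F\<^esub> (g (x, y) \<oplus>\<^bsub>F\<^esub> g (x', y)) | x x' y.
       x \<in> carrier M \<and> x' \<in> carrier M \<and> y \<in> carrier N} \<union>
    {g (x, y \<oplus>\<^bsub>N\<^esub> y') \<ominus>\<^bsub>F\<^esub> (g (x, y) \<oplus>\<^bsub>F\<^esub> g (x, y')) | x y y'.
       x \<in> carrier M \<and> y \<in> carrier N \<and> y' \<in> carrier N} \<union>
    {g (r \<odot>\<^bsub>M\<^esub> x, y) \<ominus>\<^bsub>F\<^esub> (r \<odot>\<^bsub>F\<^esub> g (x, y)) | r x y.
       r \<in> carrier D \<and> x \<in> carrier M \<and> y \<in> carrier N} \<union>
    {g (x, r \<odot>\<^bsub>N\<^esub> y) \<ominus>\<^bsub>F\<^esub> (r \<odot>\<^bsub>F\<^esub> g (x, y)) | r x y.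
       r \<in> carrier D \<and> x \<in> carrier M \<and> y \<in> carrier N})"

definition tensor_null ::
    "('d, 'e) ring_scheme \<Rightarrow> ('d, 'a, 'm) module_scheme \<Rightarrow> ('d, 'b, 'n) module_scheme
      \<Rightarrow> ('a \<times> 'b \<Rightarrow> 'd) set"
  where "tensor_null D M N =
    span_submodule D (free_module D (carrier M \<times> carrier N)) (tensor_relations D M N)"

definition tensor_module ::
    "('d, 'e) ring_scheme \<Rightarrow> ('d, 'a, 'm) module_scheme \<Rightarrow> ('d, 'b, 'n) module_scheme
      \<Rightarrow> ('d, ('a \<times> 'b \<Rightarrow> 'd) set) module"
  where "tensor_module D M N =
    quotient_module (free_module D (carrier M \<times> carrier N)) (tensor_null D M N)"

definition pure_tensor ::
    "('d, 'e) ring_scheme \<Rightarrow> ('d, 'a, 'm) module_scheme \<Rightarrow> ('d, 'b, 'n) module_scheme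
      \<Rightarrow> 'a \<Rightarrow> 'b \<Rightarrow> ('a \<times> 'b \<Rightarrow> 'd) set"
  where "pure_tensor D M N x y =
    tensor_null D M N +>\<^bsub>free_module D (carrier M \<times> carrier N)\<^esub> free_gen D (x, y)"

text \<open>
  The linear extension to all tensors of a map \<open>\<beta>\<close> prescribed on pure tensors, with values in
  the module \<open>P\<close>. A tensor \<open>t\<close> is a coset of formal sums; if \<open>\<beta>\<close> is bilinear, all of them have
  the same value, so the image below is a singleton.
\<close>

definition tensor_lift ::
    "('d, 'e) ring_scheme \<Rightarrow> ('d, 'c, 'p) module_scheme \<Rightarrow> ('a \<Rightarrow> 'b \<Rightarrow> 'c)
      \<Rightarrow> ('a \<times> 'b \<Rightarrow> 'd) set \<Rightarrow> 'c"
  where "tensor_lift D P \<beta> t =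
    the_elem ((\<lambda>u. \<Oplus>\<^bsub>P\<^esub>p\<in>{p. u p \<noteq> \<zero>\<^bsub>D\<^esub>}. u p \<odot>\<^bsub>P\<^esub> \<beta> (fst p) (snd p)) ` t)"

section \<open>The algebra of tensors and its action on linear maps\<close>

text \<open>The bilinear extension of the rule \<open>(a \<otimes> b) \<circ> (c \<otimes> d) = (ac) \<otimes> (db)\<close>.\<close>

definition tensor_prod ::
    "('d, 'e) ring_scheme \<Rightarrow> ('d, 'a, 'm) module_scheme
      \<Rightarrow> ('a \<times> 'a \<Rightarrow> 'd) set \<Rightarrow> ('a \<times> 'a \<Rightarrow> 'd) set \<Rightarrow> ('a \<times> 'a \<Rightarrow> 'd) set"
  where "tensor_prod D A s t =
    tensor_lift D (tensor_module D A A)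
      (\<lambda>a b. tensor_lift D (tensor_module D A A)
        (\<lambda>c d. pure_tensor D A A (a \<otimes>\<^bsub>A\<^esub> c) (d \<otimes>\<^bsub>A\<^esub> b)) t) s"

definition tensor_algebra ::
    "('d, 'e) ring_scheme \<Rightarrow> ('d, 'a, 'm) module_scheme \<Rightarrow> ('d, ('a \<times> 'a \<Rightarrow> 'd) set) module"
  where "tensor_algebra D A = (tensor_module D A A)\<lparr>mult := tensor_prod D A\<rparr>"

definition tensor_action ::
    "('d, 'e) ring_scheme \<Rightarrow> ('d, 'a, 'm) module_scheme
      \<Rightarrow> ('a \<times> 'a \<Rightarrow> 'd) set \<Rightarrow> ('a \<Rightarrow> 'a) \<Rightarrow> ('a \<Rightarrow> 'a)"
  where "tensor_action D A =
    tensor_lift D (linear_end D (linear_end D A))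
      (\<lambda>a b. \<lambda>f\<in>carrier (linear_end D A). \<lambda>x\<in>carrier A. (a \<otimes>\<^bsub>A\<^esub> f x) \<otimes>\<^bsub>A\<^esub> b)"

end

theory Submission
  imports Defs
begin

text \<open>
  Everything rests on the universal property of \<open>A \<otimes> A\<close>: a bilinear map extends to exactly one
  linear map on tensors. Existence (\<open>tensor_lift_linear\<close>, \<open>tensor_lift_pure\<close>) holds because the
  linear map that a bilinear \<open>\<beta>\<close> induces on formal sums of pairs kills the defining relations, hence
  the submodule they span, and so is constant on each coset. Uniqueness (\<open>linear_on_tensor_eqI\<close>)
  holds because pure tensors span.

  Existence makes the product and the action meaningful. Both arise as lifts: for pure arguments
  \<open>(ac) \<otimes> (db)\<close> is bilinear in \<open>(c, d)\<close> and in \<open>(a, b)\<close>, and \<open>f \<mapsto> afb\<close> is bilinear in \<open>(a, b)\<close>.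
  The product needs two nested lifts, so the inner lift must depend linearly on the parameters of
  its bilinear map; \<open>tensor_lift_linear_in_parameter\<close> supplies this.

  Uniqueness then reduces every identity to pure tensors. There, associativity of the product and
  multiplicativity of the action both become associativity of \<open>A\<close>. The reversed order \<open>db\<close> in the product is what makes the action multiplicative:
  \<open>a(cfd)b = (ac)f(db)\<close>. Finally, \<open>afb\<close> is the map \<open>x \<mapsto> axb\<close> composed with \<open>f\<close>, so \<open>t \<circ> f\<close> is
  \<open>t \<circ> \<delta>\<close> composed with \<open>f\<close> for every tensor \<open>t\<close>. Thus a tensor acts entirely through the
  transformation \<open>t \<circ> \<delta>\<close>, and multiplicativity of \<open>t \<mapsto> t \<circ> \<delta>\<close> follows from that of the action.
\<close>

section \<open>Linear and bilinear maps\<close>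

text \<open>
  Unlike membership in \<open>linear_maps\<close>, linearity in this sense says nothing about values outside the
  carrier, so maps can be written as plain abstractions and composed without restricting them.
\<close>

definition linear_on ::
    "('d, 'e) ring_scheme \<Rightarrow> ('d, 'a, 'm) module_scheme \<Rightarrow> ('d, 'b, 'n) module_scheme \<Rightarrow> ('a \<Rightarrow> 'b) \<Rightarrow> bool"
  where "linear_on D M N f \<longleftrightarrow>
    (\<forall>x\<in>carrier M. f x \<in> carrier N) \<and>
    (\<forall>x\<in>carrier M. \<forall>y\<in>carrier M. f (x \<oplus>\<^bsub>M\<^esub> y) = f x \<oplus>\<^bsub>N\<^esub> f y) \<and>
    (\<forall>r\<in>carrier D. \<forall>x\<in>carrier M. f (r \<odot>\<^bsub>M\<^esub> x) = r \<odot>\<^bsub>N\<^esub> f x)"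

definition bilinear_on ::
    "('d, 'e) ring_scheme \<Rightarrow> ('d, 'a, 'm) module_scheme \<Rightarrow> ('d, 'b, 'n) module_scheme
      \<Rightarrow> ('d, 'c, 'p) module_scheme \<Rightarrow> ('a \<Rightarrow> 'b \<Rightarrow> 'c) \<Rightarrow> bool"
  where "bilinear_on D M N P \<beta> \<longleftrightarrow>
    (\<forall>x\<in>carrier M. linear_on D N P (\<beta> x)) \<and> (\<forall>y\<in>carrier N. linear_on D M P (\<lambda>x. \<beta> x y))"

lemma linear_onI:
  assumes "\<And>x. x \<in> carrier M \<Longrightarrow> f x \<in> carrier N"
    and "\<And>x y. \<lbrakk>x \<in> carrier M; y \<in> carrier M\<rbrakk> \<Longrightarrow> f (x \<oplus>\<^bsub>M\<^esub> y) = f x \<oplus>\<^bsub>N\<^esub> f y"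
    and "\<And>r x. \<lbrakk>r \<in> carrier D; x \<in> carrier M\<rbrakk> \<Longrightarrow> f (r \<odot>\<^bsub>M\<^esub> x) = r \<odot>\<^bsub>N\<^esub> f x"
  shows "linear_on D M N f"
  using assms by (simp add: linear_on_def)

lemma linear_onD:
  assumes "linear_on D M N f"
  shows "x \<in> carrier M \<Longrightarrow> f x \<in> carrier N"
    and "\<lbrakk>x \<in> carrier M; y \<in> carrier M\<rbrakk> \<Longrightarrow> f (x \<oplus>\<^bsub>M\<^esub> y) = f x \<oplus>\<^bsub>N\<^esub> f y"
    and "\<lbrakk>r \<in> carrier D; x \<in> carrier M\<rbrakk> \<Longrightarrow> f (r \<odot>\<^bsub>M\<^esub> x) = r \<odot>\<^bsub>N\<^esub> f x"
  using assms by (simp_all add: linear_on_def)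

lemma bilinear_onI:
  assumes "\<And>x. x \<in> carrier M \<Longrightarrow> linear_on D N P (\<beta> x)"
    and "\<And>y. y \<in> carrier N \<Longrightarrow> linear_on D M P (\<lambda>x. \<beta> x y)"
  shows "bilinear_on D M N P \<beta>"
  using assms by (simp add: bilinear_on_def)

lemma bilinear_onD:
  assumes "bilinear_on D M N P \<beta>"
  shows "x \<in> carrier M \<Longrightarrow> linear_on D N P (\<beta> x)"
    and "y \<in> carrier N \<Longrightarrow> linear_on D M P (\<lambda>x. \<beta> x y)"
  using assms by (simp_all add: bilinear_on_def)

lemma linear_on_comp:
  assumes "linear_on D M N f" "linear_on D N P g"
  shows "linear_on D M P (\<lambda>x. g (f x))"
  using assms by (simp add: linear_on_def)

lemma bilinear_on_comp:
  assumes "bilinear_on D M N P \<beta>" "linear_on D M' M f" "linear_on D N' N g"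
  shows "bilinear_on D M' N' P (\<lambda>x y. \<beta> (f x) (g y))"
  using assms linear_onD(1)[OF assms(2)] linear_onD(1)[OF assms(3)]
  by (intro bilinear_onI)
    (auto intro: linear_on_comp[OF assms(3)] linear_on_comp[OF assms(2)] simp: bilinear_onD)

lemma linear_on_cong:
  assumes "module D M" "\<And>x. x \<in> carrier M \<Longrightarrow> f x = g x"
  shows "linear_on D M N f \<longleftrightarrow> linear_on D M N g"
proof -
  interpret module D M by fact
  show ?thesis using assms(2) by (simp add: linear_on_def)
qed

lemma linear_on_abelian_group_hom:
  assumes "module D M" "module D N" "linear_on D M N f"
  shows "abelian_group_hom M N f"
proof -
  interpret M: module D M by fact
  interpret N: module D N by fact
  have "f \<in> hom (add_monoid M) (add_monoid N)"
    using assms(3) by (auto simp: hom_def linear_on_def)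
  then show ?thesis
    by (intro abelian_group_homI M.abelian_group_axioms N.abelian_group_axioms
        group_hom.intro group_hom_axioms.intro M.a_group N.a_group)
qed

lemma linear_maps_iff:
  "f \<in> linear_maps D M N \<longleftrightarrow> f \<in> extensional (carrier M) \<and> linear_on D M N f"
  by (auto simp: linear_maps_def linear_on_def PiE_iff)

text \<open>
  Passes between linearity and membership in \<open>linear_maps\<close>, whose elements are extensional.
\<close>

lemma linear_on_restrict:
  assumes "module D M"
  shows "linear_on D M N (restrict f (carrier M)) \<longleftrightarrow> linear_on D M N f"
  using assms by (intro linear_on_cong) simp_all

lemma (in bilinear_algebra) product_bilinear: "bilinear_on D A A A (\<lambda>x y. x \<otimes>\<^bsub>A\<^esub> y)"
  by (intro bilinear_onI linear_onI)
    (simp_all add: prod_closed prod_add_left prod_add_right prod_smult_left prod_smult_right)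

lemma (in bilinear_algebra) product_linear:
  assumes "a \<in> carrier A"
  shows "linear_on D A A (\<lambda>x. a \<otimes>\<^bsub>A\<^esub> x)" "linear_on D A A (\<lambda>x. x \<otimes>\<^bsub>A\<^esub> a)"
  using bilinear_onD(1)[OF product_bilinear assms] bilinear_onD(2)[OF product_bilinear assms] by simp_all

section \<open>The algebra of linear endomorphisms\<close>

lemma linear_end_simps:
  "carrier (linear_end D M) = linear_maps D M M"
  "mult (linear_end D M) f g = compose (carrier M) f g"
  "zero (linear_end D M) = (\<lambda>x\<in>carrier M. \<zero>\<^bsub>M\<^esub>)"
  "add (linear_end D M) f g = (\<lambda>x\<in>carrier M. f x \<oplus>\<^bsub>M\<^esub> g x)"
  "smult (linear_end D M) r f = (\<lambda>x\<in>carrier M. r \<odot>\<^bsub>M\<^esub> f x)"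
  by (simp_all add: linear_end_def)

lemma linear_end_eqI:
  assumes "f \<in> carrier (linear_end D M)" "g \<in> carrier (linear_end D M)"
    and "\<And>x. x \<in> carrier M \<Longrightarrow> f x = g x"
  shows "f = g"
  using assms by (auto simp: linear_end_simps linear_maps_iff intro: extensionalityI)

lemma identity_map_in_linear_end:
  assumes "module D M"
  shows "identity_map M \<in> carrier (linear_end D M)"
  unfolding linear_end_simps identity_map_def
  using assms by (simp add: linear_maps_iff linear_on_restrict) (simp add: linear_on_def)

lemma identity_map_apply: "x \<in> carrier M \<Longrightarrow> identity_map M x = x"
  by (simp add: identity_map_def)

context module
begin

lemma linear_on_add:
  assumes "module R N" "linear_on R N M f" "linear_on R N M g"
  shows "linear_on R N M (\<lambda>x. f x \<oplus>\<^bsub>M\<^esub> g x)"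
proof -
  note f = linear_onD[OF assms(2)] and g = linear_onD[OF assms(3)]
  show ?thesis
    by (rule linear_onI) (simp_all add: f g M.a_ac smult_r_distr)
qed

text \<open>
  Commutativity of the ring is essential: the scalar \<open>r\<close> has to move past the scalars that the map
  is required to respect.
\<close>

lemma linear_on_smult:
  assumes "module R N" "linear_on R N M f" "r \<in> carrier R"
  shows "linear_on R N M (\<lambda>x. r \<odot>\<^bsub>M\<^esub> f x)"
proof -
  note f = linear_onD[OF assms(2)]
  have "r \<odot>\<^bsub>M\<^esub> (s \<odot>\<^bsub>M\<^esub> f x) = s \<odot>\<^bsub>M\<^esub> (r \<odot>\<^bsub>M\<^esub> f x)"
    if "s \<in> carrier R" "x \<in> carrier N" for s x
    using that assms(3) f by (simp add: smult_assoc1[symmetric] R.m_comm)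
  then show ?thesis
    using assms(3) by (intro linear_onI) (simp_all add: f smult_r_distr)
qed

lemma linear_on_zero: "linear_on R N M (\<lambda>x. \<zero>\<^bsub>M\<^esub>)"
  by (simp add: linear_on_def)

lemma linear_end_closed:
  shows "\<zero>\<^bsub>linear_end R M\<^esub> \<in> carrier (linear_end R M)"
    and "\<lbrakk>f \<in> carrier (linear_end R M); g \<in> carrier (linear_end R M)\<rbrakk>
      \<Longrightarrow> f \<oplus>\<^bsub>linear_end R M\<^esub> g \<in> carrier (linear_end R M)"
    and "\<lbrakk>r \<in> carrier R; f \<in> carrier (linear_end R M)\<rbrakk>
      \<Longrightarrow> r \<odot>\<^bsub>linear_end R M\<^esub> f \<in> carrier (linear_end R M)"
    and "\<lbrakk>f \<in> carrier (linear_end R M); g \<in> carrier (linear_end R M)\<rbrakk>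
      \<Longrightarrow> f \<otimes>\<^bsub>linear_end R M\<^esub> g \<in> carrier (linear_end R M)"
  unfolding linear_end_simps compose_def
  by (auto simp: linear_maps_iff linear_on_restrict[OF module_axioms]
      intro: linear_on_zero linear_on_add linear_on_smult module_axioms linear_on_comp[of R M M _ M])

lemma linear_end_value:
  assumes "f \<in> carrier (linear_end R M)"
  shows "x \<in> carrier M \<Longrightarrow> f x \<in> carrier M"
    and "\<lbrakk>x \<in> carrier M; y \<in> carrier M\<rbrakk> \<Longrightarrow> f (x \<oplus>\<^bsub>M\<^esub> y) = f x \<oplus>\<^bsub>M\<^esub> f y"
    and "\<lbrakk>r \<in> carrier R; x \<in> carrier M\<rbrakk> \<Longrightarrow> f (r \<odot>\<^bsub>M\<^esub> x) = r \<odot>\<^bsub>M\<^esub> f x"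
  using assms linear_onD[of R M M f] by (simp_all add: linear_end_simps linear_maps_iff)

lemma linear_end_apply:
  assumes "x \<in> carrier M"
  shows "\<zero>\<^bsub>linear_end R M\<^esub> x = \<zero>\<^bsub>M\<^esub>"
    and "(f \<oplus>\<^bsub>linear_end R M\<^esub> g) x = f x \<oplus>\<^bsub>M\<^esub> g x"
    and "(r \<odot>\<^bsub>linear_end R M\<^esub> f) x = r \<odot>\<^bsub>M\<^esub> f x"
    and "(f \<otimes>\<^bsub>linear_end R M\<^esub> g) x = f (g x)"
  using assms by (simp_all add: linear_end_simps compose_def)

lemmas linear_end_rules = linear_end_closed linear_end_value linear_end_apply

text \<open>
  Turns an action on a module of maps, such as \<open>t \<mapsto> (f \<mapsto> t \<circ> f)\<close>, into linear dependence of
  \<open>t \<circ> f\<close> on \<open>t\<close> for a fixed \<open>f\<close>.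
\<close>

lemma linear_end_evaluation_linear:
  assumes "x \<in> carrier M"
  shows "linear_on R (linear_end R M) M (\<lambda>f. f x)"
  using assms by (intro linear_onI) (simp_all add: linear_end_rules)

lemma linear_end_module: "module R (linear_end R M)"
proof -
  let ?E = "linear_end R M"
  have "abelian_group ?E"
  proof (rule abelian_groupI)
    fix f assume f: "f \<in> carrier ?E"
    \<comment> \<open>The negative is the multiple by \<open>-1\<close>, so it is linear because multiples are.\<close>
    have "(\<ominus> \<one>) \<odot>\<^bsub>?E\<^esub> f \<oplus>\<^bsub>?E\<^esub> f = \<zero>\<^bsub>?E\<^esub>"
      by (rule linear_end_eqI[of _ R M])
        (use f in \<open>simp_all add: linear_end_rules smult_l_minus M.l_neg\<close>)
    then show "\<exists>g\<in>carrier ?E. g \<oplus>\<^bsub>?E\<^esub> f = \<zero>\<^bsub>?E\<^esub>"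
      using f linear_end_closed(3)[of "\<ominus> \<one>" f] by blast
  qed (simp add: linear_end_closed | rule linear_end_eqI[of _ R M]; simp add: linear_end_rules M.a_ac)+
  then show ?thesis
    by (rule moduleI[OF R.is_cring])
      (simp add: linear_end_closed | rule linear_end_eqI[of _ R M];
        simp add: linear_end_rules smult_l_distr smult_r_distr smult_assoc1)+
qed

lemma linear_end_associative_algebra: "associative_algebra R (linear_end R M)"
  by (intro associative_algebra.intro bilinear_algebra.intro linear_end_module
      bilinear_algebra_axioms.intro associative_algebra_axioms.intro)
    (simp add: linear_end_closed | rule linear_end_eqI[of _ R M];
      simp add: linear_end_rules)+

end

section \<open>Free modules\<close>

lemma free_module_simps:
  "carrier (free_module D X) =
    {u. (\<forall>p. u p \<in> carrier D) \<and> (\<forall>p. p \<notin> X \<longrightarrow> u p = \<zero>\<^bsub>D\<^esub>) \<and> finite {p. u p \<noteq> \<zero>\<^bsub>D\<^esub>}}"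
  "zero (free_module D X) = (\<lambda>p. \<zero>\<^bsub>D\<^esub>)"
  "add (free_module D X) u v = (\<lambda>p. u p \<oplus>\<^bsub>D\<^esub> v p)"
  "smult (free_module D X) r u = (\<lambda>p. r \<otimes>\<^bsub>D\<^esub> u p)"
  by (simp_all add: free_module_def)

lemma free_moduleD:
  assumes "u \<in> carrier (free_module D X)"
  shows "u p \<in> carrier D" "p \<notin> X \<Longrightarrow> u p = \<zero>\<^bsub>D\<^esub>" "finite {p. u p \<noteq> \<zero>\<^bsub>D\<^esub>}" "{p. u p \<noteq> \<zero>\<^bsub>D\<^esub>} \<subseteq> X"
  using assms by (auto simp: free_module_simps)

lemma finite_support_subset:
  assumes "finite S" "\<And>p. p \<notin> S \<Longrightarrow> u p = z"
  shows "finite {p. u p \<noteq> z}"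
  using assms by (metis (mono_tags, lifting) finite_subset mem_Collect_eq subsetI)

context cring
begin

lemma free_gen_closed:
  assumes "p \<in> X"
  shows "free_gen R p \<in> carrier (free_module R X)"
  using assms by (auto simp: free_module_simps free_gen_def intro: finite_support_subset[of "{p}"])

lemma free_module_closed:
  shows "\<zero>\<^bsub>free_module R X\<^esub> \<in> carrier (free_module R X)"
    and "\<lbrakk>u \<in> carrier (free_module R X); v \<in> carrier (free_module R X)\<rbrakk>
      \<Longrightarrow> u \<oplus>\<^bsub>free_module R X\<^esub> v \<in> carrier (free_module R X)"
    and "\<lbrakk>r \<in> carrier R; u \<in> carrier (free_module R X)\<rbrakk>
      \<Longrightarrow> r \<odot>\<^bsub>free_module R X\<^esub> u \<in> carrier (free_module R X)"
proof -
  show "\<zero>\<^bsub>free_module R X\<^esub> \<in> carrier (free_module R X)"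
    by (simp add: free_module_simps)
next
  assume u: "u \<in> carrier (free_module R X)" and v: "v \<in> carrier (free_module R X)"
  have "finite {p. u p \<oplus> v p \<noteq> \<zero>}"
    using free_moduleD(3)[OF u] free_moduleD(3)[OF v]
    by - (rule finite_support_subset[of "{p. u p \<noteq> \<zero>} \<union> {p. v p \<noteq> \<zero>}"]; auto)
  then show "u \<oplus>\<^bsub>free_module R X\<^esub> v \<in> carrier (free_module R X)"
    using u v by (simp add: free_module_simps)
next
  assume r: "r \<in> carrier R" and u: "u \<in> carrier (free_module R X)"
  have "finite {p. r \<otimes> u p \<noteq> \<zero>}"
    using r free_moduleD(3)[OF u] by - (rule finite_support_subset[of "{p. u p \<noteq> \<zero>}"]; auto)
  then show "r \<odot>\<^bsub>free_module R X\<^esub> u \<in> carrier (free_module R X)"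
    using r u by (simp add: free_module_simps)
qed

lemma free_module_is_module: "module R (free_module R X)"
proof -
  let ?F = "free_module R X"
  have "abelian_group ?F"
  proof (rule abelian_groupI)
    fix u assume u: "u \<in> carrier ?F"
    have "(\<ominus> \<one>) \<odot>\<^bsub>?F\<^esub> u \<oplus>\<^bsub>?F\<^esub> u = \<zero>\<^bsub>?F\<^esub>"
      using free_moduleD(1)[OF u] by (simp add: free_module_simps l_minus l_neg)
    then show "\<exists>v\<in>carrier ?F. v \<oplus>\<^bsub>?F\<^esub> u = \<zero>\<^bsub>?F\<^esub>"
      using free_module_closed(3)[of "\<ominus> \<one>" u] u by blast
  qed (simp add: free_module_closed | simp add: free_module_simps a_ac)+
  then show ?thesis
    by (rule moduleI[OF is_cring])
      (simp add: free_module_closed | simp add: free_module_simps l_distr r_distr m_assoc)+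
qed

text \<open>
  Formal sums are built from zero by adding one multiple of a generator at a time.
\<close>

lemma free_module_induct [consumes 1, case_names zero step]:
  assumes "u \<in> carrier (free_module R X)"
    and zero: "Q \<zero>\<^bsub>free_module R X\<^esub>"
    and step: "\<And>r p v. \<lbrakk>r \<in> carrier R; p \<in> X; v \<in> carrier (free_module R X); Q v\<rbrakk>
      \<Longrightarrow> Q ((r \<odot>\<^bsub>free_module R X\<^esub> free_gen R p) \<oplus>\<^bsub>free_module R X\<^esub> v)"
  shows "Q u"
proof -
  let ?F = "free_module R X"
  have "Q u" if "finite S" "S \<subseteq> X" "u \<in> carrier ?F" "{p. u p \<noteq> \<zero>} \<subseteq> S" for S u
    using that
  proof (induction S arbitrary: u rule: finite_induct)
    case empty
    then have "u = \<zero>\<^bsub>?F\<^esub>"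
      by (auto simp: free_module_simps)
    then show ?case using zero by simp
  next
    case (insert p S)
    let ?v = "u(p := \<zero>)"
    have "finite {q. ?v q \<noteq> \<zero>}"
      using insert by - (rule finite_support_subset[of S]; auto)
    then have v: "?v \<in> carrier ?F"
      using insert.prems by (auto simp: free_module_simps)
    have "{q. ?v q \<noteq> \<zero>} \<subseteq> S"
      using insert.prems by auto
    then have "Q ?v"
      using insert.IH v insert.prems(1) by blast
    moreover have "p \<in> X"
      using insert.prems(1) by simp
    ultimately have "Q ((u p \<odot>\<^bsub>?F\<^esub> free_gen R p) \<oplus>\<^bsub>?F\<^esub> ?v)"
      using step[OF free_moduleD(1)[OF insert.prems(2)] _ v] by blast
    moreover have "(u p \<odot>\<^bsub>?F\<^esub> free_gen R p) \<oplus>\<^bsub>?F\<^esub> ?v = u"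
      using insert.prems by (auto simp: free_module_simps free_gen_def)
    ultimately show ?case by simp
  qed
  from this[of "{p. u p \<noteq> \<zero>}" u] show ?thesis
    using assms(1) free_moduleD[OF assms(1)] by simp
qed

end

text \<open>
  The linear extension of \<open>g\<close> from generators to formal sums, spelled as in the definition of
  \<open>tensor_lift\<close>.
\<close>

definition free_eval ::
    "('d, 'e) ring_scheme \<Rightarrow> ('d, 'c, 'p) module_scheme \<Rightarrow> ('x \<Rightarrow> 'c) \<Rightarrow> ('x \<Rightarrow> 'd) \<Rightarrow> 'c"
  where "free_eval D P g u = (\<Oplus>\<^bsub>P\<^esub>p\<in>{p. u p \<noteq> \<zero>\<^bsub>D\<^esub>}. u p \<odot>\<^bsub>P\<^esub> g p)"

context module
begin

text \<open>
  The support of a sum or a multiple of formal sums is in general only contained in the obvious set;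
  enlarging the index set by zero terms lets all sums run over the same set.
\<close>

lemma free_eval_superset:
  assumes "finite S" "S \<subseteq> X" "{p. u p \<noteq> \<zero>} \<subseteq> S" "\<And>p. u p \<in> carrier R" "g \<in> X \<rightarrow> carrier M"
  shows "free_eval R M g u = (\<Oplus>\<^bsub>M\<^esub>p\<in>S. u p \<odot>\<^bsub>M\<^esub> g p)"
  unfolding free_eval_def
  using assms by (intro M.add.finprod_mono_neutral_cong_left) (auto simp: Pi_iff subset_iff)

lemma free_eval_gen:
  assumes "p \<in> X" "g \<in> X \<rightarrow> carrier M"
  shows "free_eval R M g (free_gen R p) = g p"
proof -
  have "free_eval R M g (free_gen R p) = (\<Oplus>\<^bsub>M\<^esub>q\<in>{p}. free_gen R p q \<odot>\<^bsub>M\<^esub> g q)"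
    using assms by (intro free_eval_superset[of _ X]) (auto simp: free_gen_def)
  then show ?thesis
    using assms by (simp add: free_gen_def Pi_iff)
qed

lemma free_eval_linear:
  assumes g: "g \<in> X \<rightarrow> carrier M"
  shows "linear_on R (free_module R X) M (free_eval R M g)"
proof (rule linear_onI)
  fix u assume u: "u \<in> carrier (free_module R X)"
  show "free_eval R M g u \<in> carrier M"
    unfolding free_eval_def using g free_moduleD[OF u]
    by (intro M.finsum_closed) (auto simp: Pi_iff)
next
  fix u v assume u: "u \<in> carrier (free_module R X)" and v: "v \<in> carrier (free_module R X)"
  let ?S = "{p. u p \<noteq> \<zero>} \<union> {p. v p \<noteq> \<zero>}"
  note uD = free_moduleD[OF u] and vD = free_moduleD[OF v]
  have S: "finite ?S" "?S \<subseteq> X"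
    using uD(3,4) vD(3,4) by simp_all
  have gS: "g p \<in> carrier M" if "p \<in> ?S" for p
    using g S(2) that by auto
  have "free_eval R M g (u \<oplus>\<^bsub>free_module R X\<^esub> v) = (\<Oplus>\<^bsub>M\<^esub>p\<in>?S. (u p \<oplus> v p) \<odot>\<^bsub>M\<^esub> g p)"
    unfolding free_module_simps using S g uD(1) vD(1) by (intro free_eval_superset[of _ X]) auto
  also have "\<dots> = (\<Oplus>\<^bsub>M\<^esub>p\<in>?S. u p \<odot>\<^bsub>M\<^esub> g p \<oplus>\<^bsub>M\<^esub> v p \<odot>\<^bsub>M\<^esub> g p)"
    using gS uD(1) vD(1) by (intro M.finsum_cong') (auto simp: smult_l_distr)
  also have "\<dots> = (\<Oplus>\<^bsub>M\<^esub>p\<in>?S. u p \<odot>\<^bsub>M\<^esub> g p) \<oplus>\<^bsub>M\<^esub> (\<Oplus>\<^bsub>M\<^esub>p\<in>?S. v p \<odot>\<^bsub>M\<^esub> g p)"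
    using gS uD(1) vD(1) by (intro M.finsum_addf) auto
  also have "\<dots> = free_eval R M g u \<oplus>\<^bsub>M\<^esub> free_eval R M g v"
    using S g uD(1) vD(1)
      free_eval_superset[of ?S X u g] free_eval_superset[of ?S X v g] by simp
  finally show "free_eval R M g (u \<oplus>\<^bsub>free_module R X\<^esub> v) = free_eval R M g u \<oplus>\<^bsub>M\<^esub> free_eval R M g v" .
next
  fix r u assume r: "r \<in> carrier R" and u: "u \<in> carrier (free_module R X)"
  let ?S = "{p. u p \<noteq> \<zero>}"
  note uD = free_moduleD[OF u]
  have gS: "g p \<in> carrier M" if "p \<in> ?S" for p
    using g uD(4) that by auto
  have "free_eval R M g (r \<odot>\<^bsub>free_module R X\<^esub> u) = (\<Oplus>\<^bsub>M\<^esub>p\<in>?S. (r \<otimes> u p) \<odot>\<^bsub>M\<^esub> g p)"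
    unfolding free_module_simps using uD r g by (intro free_eval_superset[of _ X]) auto
  also have "\<dots> = (\<Oplus>\<^bsub>M\<^esub>p\<in>?S. r \<odot>\<^bsub>M\<^esub> (u p \<odot>\<^bsub>M\<^esub> g p))"
    using gS uD(1) r by (intro M.finsum_cong') (auto simp: smult_assoc1)
  also have "\<dots> = r \<odot>\<^bsub>M\<^esub> free_eval R M g u"
    unfolding free_eval_def using gS uD(1,3) r by (intro finsum_smult_ldistr[symmetric]) auto
  finally show "free_eval R M g (r \<odot>\<^bsub>free_module R X\<^esub> u) = r \<odot>\<^bsub>M\<^esub> free_eval R M g u" .
qed

end

section \<open>Submodules and quotients\<close>

context module
begin

lemma span_submodule_is_submodule:
  assumes "X \<subseteq> carrier M"
  shows "submodule (span_submodule R M X) R M"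
proof -
  let ?\<N> = "{N. submodule N R M \<and> X \<subseteq> N}"
  have "carrier M \<in> ?\<N>"
    using assms carrier_is_submodule by simp
  then show ?thesis
    unfolding span_submodule_def
    by (intro submoduleI)
      (auto intro: submoduleE(3-5) dest: subgroup.one_closed[OF submodule.axioms(1)])
qed

lemma span_submodule_superset: "X \<subseteq> span_submodule R M X"
  by (auto simp: span_submodule_def)

lemma span_submodule_least:
  assumes "submodule N R M" "X \<subseteq> N"
  shows "span_submodule R M X \<subseteq> N"
  using assms by (auto simp: span_submodule_def)

lemma linear_kernel_submodule:
  assumes "module R P" "linear_on R M P h"
  shows "submodule {x \<in> carrier M. h x = \<zero>\<^bsub>P\<^esub>} R M"
proof -
  interpret P: module R P by fact
  interpret h: abelian_group_hom M P h
    using linear_on_abelian_group_hom[OF module_axioms assms] .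
  show ?thesis
    by (rule submoduleI) (auto simp: linear_onD[OF assms(2)])
qed

lemma submodule_abelian_subgroup:
  assumes "submodule N R M"
  shows "abelian_subgroup N M"
  using assms by (intro abelian_subgroupI3 additive_subgroup.intro submodule.axioms(1) M.abelian_group_axioms)

text \<open>
  The operations are computed on representatives, so that the coset map is linear and onto, and the
  module laws of the quotient are inherited from the module.
\<close>

lemma quotient_module_coset:
  assumes N: "submodule N R M"
  shows "carrier (quotient_module M N) = (\<lambda>u. N +>\<^bsub>M\<^esub> u) ` carrier M"
    and "\<zero>\<^bsub>quotient_module M N\<^esub> = N +>\<^bsub>M\<^esub> \<zero>\<^bsub>M\<^esub>"
    and "\<lbrakk>u \<in> carrier M; v \<in> carrier M\<rbrakk>
      \<Longrightarrow> (N +>\<^bsub>M\<^esub> u) \<oplus>\<^bsub>quotient_module M N\<^esub> (N +>\<^bsub>M\<^esub> v) = N +>\<^bsub>M\<^esub> (u \<oplus>\<^bsub>M\<^esub> v)"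
    and "\<lbrakk>r \<in> carrier R; u \<in> carrier M\<rbrakk>
      \<Longrightarrow> r \<odot>\<^bsub>quotient_module M N\<^esub> (N +>\<^bsub>M\<^esub> u) = N +>\<^bsub>M\<^esub> (r \<odot>\<^bsub>M\<^esub> u)"
proof -
  interpret N: abelian_subgroup N M
    using submodule_abelian_subgroup[OF N] .
  show "carrier (quotient_module M N) = (\<lambda>u. N +>\<^bsub>M\<^esub> u) ` carrier M"
    by (auto simp: quotient_module_def A_RCOSETS_def')
  show "\<zero>\<^bsub>quotient_module M N\<^esub> = N +>\<^bsub>M\<^esub> \<zero>\<^bsub>M\<^esub>"
    using N.a_subset by (simp add: quotient_module_def)
  show "(N +>\<^bsub>M\<^esub> u) \<oplus>\<^bsub>quotient_module M N\<^esub> (N +>\<^bsub>M\<^esub> v) = N +>\<^bsub>M\<^esub> (u \<oplus>\<^bsub>M\<^esub> v)"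
    if "u \<in> carrier M" "v \<in> carrier M"
    using that by (simp add: quotient_module_def N.a_rcos_sum)
  assume r: "r \<in> carrier R" and u: "u \<in> carrier M"
  have "N +>\<^bsub>M\<^esub> (r \<odot>\<^bsub>M\<^esub> w) = N +>\<^bsub>M\<^esub> (r \<odot>\<^bsub>M\<^esub> u)" if "w \<in> N +>\<^bsub>M\<^esub> u" for w
  proof -
    obtain n where n: "n \<in> N" "w = n \<oplus>\<^bsub>M\<^esub> u"
      using \<open>w \<in> N +>\<^bsub>M\<^esub> u\<close> by (auto simp: a_r_coset_def')
    then have "r \<odot>\<^bsub>M\<^esub> w = (r \<odot>\<^bsub>M\<^esub> n) \<oplus>\<^bsub>M\<^esub> (r \<odot>\<^bsub>M\<^esub> u)"
      using r u by (simp add: smult_r_distr)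
    then have "r \<odot>\<^bsub>M\<^esub> w \<in> N +>\<^bsub>M\<^esub> (r \<odot>\<^bsub>M\<^esub> u)"
      using submoduleE(4)[OF N r n(1)] by (auto simp: a_r_coset_def')
    then show ?thesis
      using r u N.a_repr_independence' by simp
  qed
  moreover have "u \<in> N +>\<^bsub>M\<^esub> u"
    using u by (rule N.a_rcos_self)
  ultimately have "(\<Union>w\<in>N +>\<^bsub>M\<^esub> u. N +>\<^bsub>M\<^esub> (r \<odot>\<^bsub>M\<^esub> w)) = N +>\<^bsub>M\<^esub> (r \<odot>\<^bsub>M\<^esub> u)"
    by (intro SUP_eq_const) blast+
  then show "r \<odot>\<^bsub>quotient_module M N\<^esub> (N +>\<^bsub>M\<^esub> u) = N +>\<^bsub>M\<^esub> (r \<odot>\<^bsub>M\<^esub> u)"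
    by (simp add: quotient_module_def)
qed

lemma coset_map_linear:
  assumes "submodule N R M"
  shows "linear_on R M (quotient_module M N) (\<lambda>u. N +>\<^bsub>M\<^esub> u)"
  by (rule linear_onI) (simp_all add: quotient_module_coset[OF assms])

lemma quotient_module_is_module:
  assumes N: "submodule N R M"
  shows "module R (quotient_module M N)"
proof -
  let ?Q = "quotient_module M N"
  note Q = quotient_module_coset[OF N]
  have "abelian_group ?Q"
  proof (rule abelian_groupI)
    fix U assume "U \<in> carrier ?Q"
    then obtain u where u: "u \<in> carrier M" "U = N +>\<^bsub>M\<^esub> u"
      by (auto simp: Q(1))
    then have "(N +>\<^bsub>M\<^esub> (\<ominus>\<^bsub>M\<^esub> u)) \<oplus>\<^bsub>?Q\<^esub> U = \<zero>\<^bsub>?Q\<^esub>"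
      by (simp add: Q(2,3) M.l_neg)
    then show "\<exists>V\<in>carrier ?Q. V \<oplus>\<^bsub>?Q\<^esub> U = \<zero>\<^bsub>?Q\<^esub>"
      using u(1) by (auto simp: Q(1))
  qed (auto simp: Q M.a_ac)
  then show ?thesis
    by (rule moduleI[OF R.is_cring]) (auto simp: Q smult_l_distr smult_r_distr smult_assoc1)
qed

lemma coset_eq_iff:
  assumes "submodule N R M" "u \<in> carrier M" "v \<in> carrier M"
  shows "N +>\<^bsub>M\<^esub> u = N +>\<^bsub>M\<^esub> v \<longleftrightarrow> u \<ominus>\<^bsub>M\<^esub> v \<in> N"
proof -
  interpret N: abelian_subgroup N M
    using submodule_abelian_subgroup[OF assms(1)] .
  show ?thesis
    using assms N.a_rcos_module[of v u] N.a_rcos_self[of u] N.a_repr_independence'[of u v]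
    by (auto simp: M.minus_eq)
qed

lemma linear_image_coset:
  assumes "submodule N R M" "module R P" "linear_on R M P h"
    and "\<And>n. n \<in> N \<Longrightarrow> h n = \<zero>\<^bsub>P\<^esub>" "u \<in> carrier M"
  shows "h ` (N +>\<^bsub>M\<^esub> u) = {h u}"
proof -
  interpret P: module R P by fact
  interpret N: abelian_subgroup N M
    using submodule_abelian_subgroup[OF assms(1)] .
  have "h (n \<oplus>\<^bsub>M\<^esub> u) = h u" if "n \<in> N" for n
    using that assms(4,5) linear_onD[OF assms(3)] by simp
  then have "(\<lambda>n. h (n \<oplus>\<^bsub>M\<^esub> u)) ` N = (\<lambda>n. h u) ` N"
    by (rule image_cong[OF refl])
  moreover have "h ` (N +>\<^bsub>M\<^esub> u) = (\<lambda>n. h (n \<oplus>\<^bsub>M\<^esub> u)) ` N"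
    by (auto simp: a_r_coset_def')
  ultimately show ?thesis
    using submoduleE(2)[OF assms(1)] by auto
qed

end

section \<open>The universal property of the tensor product\<close>

locale module_pair = M: module D M + N: module D N
  for D (structure) and M (structure) and N (structure)
begin

abbreviation "F \<equiv> free_module D (carrier M \<times> carrier N)"
abbreviation "MN \<equiv> tensor_module D M N"
abbreviation "pure \<equiv> pure_tensor D M N"

sublocale F: module D F
  by (rule M.free_module_is_module)

lemma tensor_relations_closed: "tensor_relations D M N \<subseteq> carrier F"
  unfolding tensor_relations_def Let_def
  by (auto intro!: F.M.minus_closed F.M.a_closed F.smult_closed M.free_gen_closed)

lemma tensor_null_submodule: "submodule (tensor_null D M N) D F"
  unfolding tensor_null_def by (rule F.span_submodule_is_submodule[OF tensor_relations_closed])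

sublocale MN: module D MN
  unfolding tensor_module_def by (rule F.quotient_module_is_module[OF tensor_null_submodule])

lemma tensor_coset_linear:
  "linear_on D F MN (\<lambda>u. tensor_null D M N +>\<^bsub>F\<^esub> u)"
  unfolding tensor_module_def by (rule F.coset_map_linear[OF tensor_null_submodule])

lemma tensor_coset_exists:
  assumes "t \<in> carrier MN"
  obtains u where "u \<in> carrier F" "t = tensor_null D M N +>\<^bsub>F\<^esub> u"
  using assms unfolding tensor_module_def F.quotient_module_coset(1)[OF tensor_null_submodule] by blast

lemma pure_closed:
  "\<lbrakk>x \<in> carrier M; y \<in> carrier N\<rbrakk> \<Longrightarrow> pure x y \<in> carrier MN"
  unfolding pure_tensor_def by (rule linear_onD(1)[OF tensor_coset_linear]) (simp add: M.free_gen_closed)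

text \<open>
  Each kind of defining relation becomes an identity between pure tensors.
\<close>

lemma tensor_coset_eqI:
  assumes "u \<ominus>\<^bsub>F\<^esub> v \<in> tensor_relations D M N" "u \<in> carrier F" "v \<in> carrier F"
  shows "tensor_null D M N +>\<^bsub>F\<^esub> u = tensor_null D M N +>\<^bsub>F\<^esub> v"
  using assms F.span_submodule_superset[of "tensor_relations D M N"]
  by (subst F.coset_eq_iff[OF tensor_null_submodule]) (auto simp: tensor_null_def)

lemma pure_bilinear: "bilinear_on D M N MN pure"
proof -
  note q = linear_onD(2,3)[OF tensor_coset_linear, symmetric]
  note gen = M.free_gen_closed[of _ "carrier M \<times> carrier N"]
  show ?thesis
    by (intro bilinear_onI linear_onI pure_closed; (assumption)?;
        unfold pure_tensor_def; (subst q; (simp add: gen; fail)?)+;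
        rule tensor_coset_eqI; (simp add: gen)?;
        unfold tensor_relations_def Let_def; blast)
qed

text \<open>
  Pure tensors span. There is no separate case for zero, since it is the multiple by the scalar zero
  of a pure tensor.
\<close>

lemma tensor_induct [consumes 1, case_names pure add smult]:
  assumes "t \<in> carrier MN"
    and pure: "\<And>x y. \<lbrakk>x \<in> carrier M; y \<in> carrier N\<rbrakk> \<Longrightarrow> Q (pure x y)"
    and add: "\<And>s t. \<lbrakk>s \<in> carrier MN; t \<in> carrier MN; Q s; Q t\<rbrakk> \<Longrightarrow> Q (s \<oplus>\<^bsub>MN\<^esub> t)"
    and smult: "\<And>r t. \<lbrakk>r \<in> carrier D; t \<in> carrier MN; Q t\<rbrakk> \<Longrightarrow> Q (r \<odot>\<^bsub>MN\<^esub> t)"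
  shows "Q t"
proof -
  let ?q = "\<lambda>u. tensor_null D M N +>\<^bsub>F\<^esub> u"
  note q = linear_onD[OF tensor_coset_linear]
  obtain u where u: "u \<in> carrier F" "t = ?q u"
    using assms(1) by (rule tensor_coset_exists)
  have "Q (?q u)"
    using u(1)
  proof (induction rule: M.free_module_induct)
    case zero
    \<comment> \<open>Any pure tensor would do; the zeros are elements certain to exist.\<close>
    have "?q \<zero>\<^bsub>F\<^esub> = \<zero>\<^bsub>D\<^esub> \<odot>\<^bsub>MN\<^esub> pure \<zero>\<^bsub>M\<^esub> \<zero>\<^bsub>N\<^esub>"
      using q(3)[of "\<zero>\<^bsub>D\<^esub>" "\<zero>\<^bsub>F\<^esub>"] q(1)[of "\<zero>\<^bsub>F\<^esub>"] by (simp add: pure_closed)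
    moreover have "Q (\<zero>\<^bsub>D\<^esub> \<odot>\<^bsub>MN\<^esub> pure \<zero>\<^bsub>M\<^esub> \<zero>\<^bsub>N\<^esub>)"
      by (intro smult pure pure_closed) simp_all
    ultimately show ?case
      by simp
  next
    case (step r p v)
    obtain x y where p: "p = (x, y)" "x \<in> carrier M" "y \<in> carrier N"
      using step(2) by blast
    have "?q (r \<odot>\<^bsub>F\<^esub> free_gen D p \<oplus>\<^bsub>F\<^esub> v) = (r \<odot>\<^bsub>MN\<^esub> pure x y) \<oplus>\<^bsub>MN\<^esub> ?q v"
      using step p M.free_gen_closed[OF step(2)] by (simp add: q pure_tensor_def)
    then show ?case
      using step p by (simp add: add smult pure pure_closed q(1))
  qed
  then show ?thesis by (simp add: u)
qed

lemma linear_on_tensor_eqI: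
  assumes "linear_on D MN P f" "linear_on D MN P g"
    and "\<And>x y. \<lbrakk>x \<in> carrier M; y \<in> carrier N\<rbrakk> \<Longrightarrow> f (pure x y) = g (pure x y)"
    and "t \<in> carrier MN"
  shows "f t = g t"
  using assms(4)
  by (induction rule: tensor_induct) (simp_all add: assms(3) linear_onD[OF assms(1)] linear_onD[OF assms(2)])

text \<open>
  Uniqueness applied in one argument at a time.
\<close>

lemma bilinear_on_tensor_eqI:
  assumes f: "bilinear_on D MN MN P f" and g: "bilinear_on D MN MN P g"
    and pure: "\<And>a b c d. \<lbrakk>a \<in> carrier M; b \<in> carrier N; c \<in> carrier M; d \<in> carrier N\<rbrakk>
      \<Longrightarrow> f (pure a b) (pure c d) = g (pure a b) (pure c d)"
    and "s \<in> carrier MN" "t \<in> carrier MN"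
  shows "f s t = g s t"
proof (rule linear_on_tensor_eqI[OF bilinear_onD(1)[OF f \<open>s \<in> carrier MN\<close>] bilinear_onD(1)[OF g \<open>s \<in> carrier MN\<close>]])
  fix c d assume cd: "c \<in> carrier M" "d \<in> carrier N"
  note t' = pure_closed[OF cd]
  show "f s (pure c d) = g s (pure c d)"
    using linear_on_tensor_eqI[OF bilinear_onD(2)[OF f t'] bilinear_onD(2)[OF g t']]
      pure cd \<open>s \<in> carrier MN\<close> by blast
qed (rule \<open>t \<in> carrier MN\<close>)

context
  fixes P :: "('a, 'p, 'q) module_scheme" and \<beta>
  assumes P: "module D P" and \<beta>: "bilinear_on D M N P \<beta>"
begin

lemma bilinear_values: "(\<lambda>p. \<beta> (fst p) (snd p)) \<in> carrier M \<times> carrier N \<rightarrow> carrier P"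
  using linear_onD(1)[OF bilinear_onD(1)[OF \<beta>]] by auto

lemma free_eval_linear_bilinear:
  "linear_on D F P (free_eval D P (\<lambda>p. \<beta> (fst p) (snd p)))"
  by (rule module.free_eval_linear[OF P bilinear_values])

text \<open>
  The heart of well-definedness: bilinearity of \<open>\<beta>\<close> says precisely that each defining relation
  lies in the kernel of the evaluation map, and a kernel that contains the relations contains the
  submodule they span.
\<close>

lemma free_eval_null:
  assumes "n \<in> tensor_null D M N"
  shows "free_eval D P (\<lambda>p. \<beta> (fst p) (snd p)) n = \<zero>\<^bsub>P\<^esub>"
proof -
  let ?h = "free_eval D P (\<lambda>p. \<beta> (fst p) (snd p))"
  interpret P: module D P by (rule P)
  interpret h: abelian_group_hom F P ?h
    using linear_on_abelian_group_hom[OF F.module_axioms P free_eval_linear_bilinear] .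
  have gen: "?h (free_gen D (x, y)) = \<beta> x y" if "x \<in> carrier M" "y \<in> carrier N" for x y
    using that P.free_eval_gen[OF _ bilinear_values, of "(x, y)"] by simp
  have "?h (u \<ominus>\<^bsub>F\<^esub> v) = \<zero>\<^bsub>P\<^esub>" if "u \<in> carrier F" "v \<in> carrier F" "?h u = ?h v" for u v
    using that by (simp add: F.M.minus_eq P.M.r_neg)
  moreover note lin = linear_onD[OF bilinear_onD(1)[OF \<beta>]] linear_onD[OF bilinear_onD(2)[OF \<beta>]]
  ultimately have "tensor_relations D M N \<subseteq> {n \<in> carrier F. ?h n = \<zero>\<^bsub>P\<^esub>}"
    unfolding tensor_relations_def Let_def
    by (auto simp: M.free_gen_closed gen lin linear_onD(3)[OF free_eval_linear_bilinear])
  then have "tensor_null D M N \<subseteq> {n \<in> carrier F. ?h n = \<zero>\<^bsub>P\<^esub>}"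
    unfolding tensor_null_def
    by (intro F.span_submodule_least F.linear_kernel_submodule P free_eval_linear_bilinear)
  then show ?thesis
    using assms by blast
qed

text \<open>
  The image of a coset in the definition of \<open>tensor_lift\<close> is thus a singleton, so the lift can be
  computed from any representative.
\<close>

lemma tensor_lift_coset:
  assumes "u \<in> carrier F"
  shows "tensor_lift D P \<beta> (tensor_null D M N +>\<^bsub>F\<^esub> u) = free_eval D P (\<lambda>p. \<beta> (fst p) (snd p)) u"
proof -
  have "free_eval D P (\<lambda>p. \<beta> (fst p) (snd p)) ` (tensor_null D M N +>\<^bsub>F\<^esub> u)
      = {free_eval D P (\<lambda>p. \<beta> (fst p) (snd p)) u}"
    using assms free_eval_null
    by (intro F.linear_image_coset[OF tensor_null_submodule P free_eval_linear_bilinear])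
  then show ?thesis
    by (simp add: tensor_lift_def free_eval_def)
qed

lemma tensor_lift_pure:
  assumes "x \<in> carrier M" "y \<in> carrier N"
  shows "tensor_lift D P \<beta> (pure x y) = \<beta> x y"
  using assms module.free_eval_gen[OF P _ bilinear_values, of "(x, y)"]
  by (simp add: pure_tensor_def tensor_lift_coset M.free_gen_closed)

lemma tensor_lift_linear: "linear_on D MN P (tensor_lift D P \<beta>)"
proof -
  note q = linear_onD(2,3)[OF tensor_coset_linear, symmetric]
  note h = linear_onD[OF free_eval_linear_bilinear]
  show ?thesis
    by (rule linear_onI; (elim tensor_coset_exists)?; simp add: q tensor_lift_coset h)
qed

end

text \<open>
  If the bilinear map depends linearly on a parameter \<open>z\<close>, so does its lift at a fixed tensor. On
  pure tensors the lift is the bilinear map itself, and the property passes to sums and multiples.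
\<close>

lemma tensor_lift_linear_in_parameter:
  assumes P: "module D P"
    and bil: "\<And>z. z \<in> carrier Z \<Longrightarrow> bilinear_on D M N P (\<gamma> z)"
    and lin: "\<And>x y. \<lbrakk>x \<in> carrier M; y \<in> carrier N\<rbrakk> \<Longrightarrow> linear_on D Z P (\<lambda>z. \<gamma> z x y)"
    and Z: "module D Z"
    and "t \<in> carrier MN"
  shows "linear_on D Z P (\<lambda>z. tensor_lift D P (\<gamma> z) t)"
proof -
  interpret P: module D P by (rule P)
  note lift = linear_onD[OF tensor_lift_linear[OF P bil]]
  show ?thesis
    using assms(5)
  proof (induction rule: tensor_induct)
    case (pure x y)
    then show ?case
      using lin linear_on_cong[OF Z, of "\<lambda>z. tensor_lift D P (\<gamma> z) (pure_tensor D M N x y)" "\<lambda>z. \<gamma> z x y" P]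
      by (simp add: tensor_lift_pure[OF P bil])
  next
    case (add s t)
    then show ?case
      using P.linear_on_add[OF Z add(3,4)]
        linear_on_cong[OF Z, of "\<lambda>z. tensor_lift D P (\<gamma> z) (s \<oplus>\<^bsub>MN\<^esub> t)"
          "\<lambda>z. tensor_lift D P (\<gamma> z) s \<oplus>\<^bsub>P\<^esub> tensor_lift D P (\<gamma> z) t" P]
      by (simp add: lift)
  next
    case (smult r t)
    then show ?case
      using P.linear_on_smult[OF Z smult(3,1)]
        linear_on_cong[OF Z, of "\<lambda>z. tensor_lift D P (\<gamma> z) (r \<odot>\<^bsub>MN\<^esub> t)"
          "\<lambda>z. r \<odot>\<^bsub>P\<^esub> tensor_lift D P (\<gamma> z) t" P]
      by (simp add: lift)
  qed
qed

end

section \<open>The tensor algebra\<close>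

context associative_algebra
begin

interpretation AA: module_pair D A A ..

abbreviation "AxA \<equiv> tensor_module D A A"
abbreviation "pure \<equiv> pure_tensor D A A"

lemma tensor_algebra_simps:
  "carrier (tensor_algebra D A) = carrier AxA"
  "zero (tensor_algebra D A) = zero AxA"
  "add (tensor_algebra D A) = add AxA"
  "smult (tensor_algebra D A) = smult AxA"
  "mult (tensor_algebra D A) = tensor_prod D A"
  by (simp_all add: tensor_algebra_def)

text \<open>
  Bilinearity in the right factor makes the inner of two nested lifts meaningful; bilinearity in the
  left factor, which follows, is passed on by the inner lift to the outer one.
\<close>

lemma inner_product_bilinear:
  assumes "a \<in> carrier A" "b \<in> carrier A"
  shows "bilinear_on D A A AxA (\<lambda>c d. pure (a \<otimes>\<^bsub>A\<^esub> c) (d \<otimes>\<^bsub>A\<^esub> b))"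
  using assms by (intro bilinear_on_comp[OF AA.pure_bilinear] product_linear)

lemma outer_product_bilinear:
  assumes "c \<in> carrier A" "d \<in> carrier A"
  shows "bilinear_on D A A AxA (\<lambda>a b. pure (a \<otimes>\<^bsub>A\<^esub> c) (d \<otimes>\<^bsub>A\<^esub> b))"
  using assms by (intro bilinear_on_comp[OF AA.pure_bilinear] product_linear)

text \<open>
  The inner of the two nested lifts, with the tensor \<open>t\<close> as right factor.
\<close>

lemma half_tensor_prod_bilinear:
  assumes "t \<in> carrier AxA"
  shows "bilinear_on D A A AxA
    (\<lambda>a b. tensor_lift D AxA (\<lambda>c d. pure (a \<otimes>\<^bsub>A\<^esub> c) (d \<otimes>\<^bsub>A\<^esub> b)) t)"
  using assms
  by (intro bilinear_onI AA.tensor_lift_linear_in_parameter AA.MN.module_axioms module_axioms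
      inner_product_bilinear bilinear_onD[OF outer_product_bilinear])

lemma tensor_prod_bilinear: "bilinear_on D AxA AxA AxA (tensor_prod D A)"
proof (rule bilinear_onI)
  fix s assume s: "s \<in> carrier AxA"
  show "linear_on D AxA AxA (tensor_prod D A s)"
    unfolding tensor_prod_def
    using s
    by (intro AA.tensor_lift_linear_in_parameter AA.MN.module_axioms half_tensor_prod_bilinear
        AA.tensor_lift_linear inner_product_bilinear)
next
  fix t assume t: "t \<in> carrier AxA"
  show "linear_on D AxA AxA (\<lambda>s. tensor_prod D A s t)"
    unfolding tensor_prod_def
    by (rule AA.tensor_lift_linear[OF AA.MN.module_axioms half_tensor_prod_bilinear[OF t]])
qed

lemma tensor_prod_pure:
  assumes "a \<in> carrier A" "b \<in> carrier A" "c \<in> carrier A" "d \<in> carrier A"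
  shows "tensor_prod D A (pure a b) (pure c d) = pure (a \<otimes>\<^bsub>A\<^esub> c) (d \<otimes>\<^bsub>A\<^esub> b)"
  using assms
  by (simp add: tensor_prod_def AA.pure_closed
      AA.tensor_lift_pure[OF AA.MN.module_axioms half_tensor_prod_bilinear]
      AA.tensor_lift_pure[OF AA.MN.module_axioms inner_product_bilinear])

text \<open>
  On pure tensors both sides are \<open>((ac)e) \<otimes> (f(db))\<close> up to associativity of \<open>A\<close>. The reduction to
  this case treats the third factor first, by linearity, and then the other two together.
\<close>

lemma tensor_prod_assoc:
  assumes "r \<in> carrier AxA" "s \<in> carrier AxA" "t \<in> carrier AxA"
  shows "tensor_prod D A (tensor_prod D A r s) t = tensor_prod D A r (tensor_prod D A s t)"
proof -
  note prod = bilinear_onD[OF tensor_prod_bilinear]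
  note closed = linear_onD(1)[OF prod(1)]
  have pure_case: "tensor_prod D A (tensor_prod D A r s) (pure e f) = tensor_prod D A r (tensor_prod D A s (pure e f))"
    if ef: "e \<in> carrier A" "f \<in> carrier A" for e f
  proof (rule AA.bilinear_on_tensor_eqI[of AxA "\<lambda>r s. tensor_prod D A (tensor_prod D A r s) (pure e f)"])
    show "bilinear_on D AxA AxA AxA (\<lambda>r s. tensor_prod D A (tensor_prod D A r s) (pure e f))"
      using AA.pure_closed[OF ef] by (intro bilinear_onI linear_on_comp[OF prod(1) prod(2)] linear_on_comp[OF prod(2) prod(2)])
    show "bilinear_on D AxA AxA AxA (\<lambda>r s. tensor_prod D A r (tensor_prod D A s (pure e f)))"
      using AA.pure_closed[OF ef] closed by (intro bilinear_onI linear_on_comp[OF prod(2) prod(1)] prod(2))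
  qed (use ef assms in \<open>simp_all add: tensor_prod_pure prod_closed prod_assoc\<close>)
  show ?thesis
    by (rule AA.linear_on_tensor_eqI[OF prod(1) linear_on_comp[OF prod(1) prod(1)]])
      (use assms closed pure_case in auto)
qed

lemma tensor_algebra_associative: "associative_algebra D (tensor_algebra D A)"
proof -
  have "abelian_group (tensor_algebra D A)"
    by (rule abelian_groupI)
      (auto simp: tensor_algebra_simps AA.MN.M.a_ac AA.MN.M.add.l_inv_ex)
  then have "module D (tensor_algebra D A)"
    by (rule moduleI[OF R.is_cring])
      (simp_all add: tensor_algebra_simps AA.MN.smult_l_distr AA.MN.smult_r_distr AA.MN.smult_assoc1)
  moreover note prod = bilinear_onD[OF tensor_prod_bilinear]
  ultimately show ?thesis
    by (intro associative_algebra.intro bilinear_algebra.intro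
        bilinear_algebra_axioms.intro associative_algebra_axioms.intro)
      (simp_all add: tensor_algebra_simps linear_onD[OF prod(1)] linear_onD[OF prod(2)] tensor_prod_assoc)
qed

section \<open>The action by sandwiching\<close>

abbreviation "L \<equiv> linear_end D A"

interpretation L: associative_algebra D L
  by (rule linear_end_associative_algebra)

interpretation EL: associative_algebra D "linear_end D L"
  by (rule L.linear_end_associative_algebra)

text \<open>
  The operator \<open>f \<mapsto> afb\<close>, restricted at both levels because the modules of linear maps consist of
  extensional functions.
\<close>

abbreviation "sandwich \<equiv> \<lambda>a b. \<lambda>f\<in>carrier L. \<lambda>x\<in>carrier A. (a \<otimes>\<^bsub>A\<^esub> f x) \<otimes>\<^bsub>A\<^esub> b"

lemma sandwich_linear:
  assumes "a \<in> carrier A" "b \<in> carrier A" "f \<in> carrier L"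
  shows "(\<lambda>x\<in>carrier A. (a \<otimes>\<^bsub>A\<^esub> f x) \<otimes>\<^bsub>A\<^esub> b) \<in> carrier L"
  using assms linear_on_comp[OF linear_on_comp[OF _ product_linear(1)] product_linear(2), of A f a b]
  by (simp add: linear_end_simps linear_maps_iff linear_on_restrict[OF module_axioms])

lemma sandwich_closed:
  assumes "a \<in> carrier A" "b \<in> carrier A"
  shows "sandwich a b \<in> carrier (linear_end D L)"
proof -
  have "linear_on D L L (\<lambda>f. \<lambda>x\<in>carrier A. (a \<otimes>\<^bsub>A\<^esub> f x) \<otimes>\<^bsub>A\<^esub> b)"
    using assms
    by - (rule linear_onI; (rule linear_end_eqI[of _ D A])?;
        simp add: sandwich_linear linear_end_rules prod_closed
          prod_add_left prod_add_right prod_smult_left prod_smult_right)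
  then show ?thesis
    unfolding linear_end_simps(1)[of D L] linear_maps_iff
    by (simp add: linear_on_restrict[OF L.module_axioms])
qed

lemma transformation_eqI:
  assumes "h \<in> carrier (linear_end D L)" "k \<in> carrier (linear_end D L)"
    and "\<And>f x. \<lbrakk>f \<in> carrier L; x \<in> carrier A\<rbrakk> \<Longrightarrow> h f x = k f x"
  shows "h = k"
proof (rule linear_end_eqI[OF assms(1,2)])
  fix f assume f: "f \<in> carrier L"
  show "h f = k f"
    using assms(3)[OF f] L.linear_end_value(1)[OF assms(1) f] L.linear_end_value(1)[OF assms(2) f]
    by (rule linear_end_eqI[rotated 2])
qed

lemma sandwich_bilinear: "bilinear_on D A A (linear_end D L) sandwich"
  by (rule bilinear_onI; rule linear_onI; (rule transformation_eqI)?)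
    (simp_all add: sandwich_closed L.linear_end_closed sandwich_linear L.linear_end_apply linear_end_rules
      prod_closed prod_add_left prod_add_right prod_smult_left prod_smult_right)

lemma tensor_action_linear: "linear_on D AxA (linear_end D L) (tensor_action D A)"
  unfolding tensor_action_def by (rule AA.tensor_lift_linear[OF EL.module_axioms sandwich_bilinear])

lemma tensor_action_pure:
  assumes "a \<in> carrier A" "b \<in> carrier A"
  shows "tensor_action D A (pure a b) = sandwich a b"
  unfolding tensor_action_def
  using assms by (rule AA.tensor_lift_pure[OF EL.module_axioms sandwich_bilinear])

text \<open>
  On pure tensors this is \<open>(ac)f(db) = a(cfd)b\<close>.
\<close>

lemma tensor_action_prod:
  assumes "s \<in> carrier AxA" "t \<in> carrier AxA"
  shows "tensor_action D A (tensor_prod D A s t) = tensor_action D A s \<otimes>\<^bsub>linear_end D L\<^esub> tensor_action D A t"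
proof (rule AA.bilinear_on_tensor_eqI[of "linear_end D L" "\<lambda>s t. tensor_action D A (tensor_prod D A s t)"])
  show "bilinear_on D AxA AxA (linear_end D L) (\<lambda>s t. tensor_action D A (tensor_prod D A s t))"
    by (intro bilinear_onI linear_on_comp[OF _ tensor_action_linear] bilinear_onD[OF tensor_prod_bilinear])
  show "bilinear_on D AxA AxA (linear_end D L) (\<lambda>s t. tensor_action D A s \<otimes>\<^bsub>linear_end D L\<^esub> tensor_action D A t)"
    by (rule bilinear_on_comp[OF EL.product_bilinear tensor_action_linear tensor_action_linear])
  fix a b c d assume A: "a \<in> carrier A" "b \<in> carrier A" "c \<in> carrier A" "d \<in> carrier A"
  show "tensor_action D A (tensor_prod D A (pure a b) (pure c d))
      = tensor_action D A (pure a b) \<otimes>\<^bsub>linear_end D L\<^esub> tensor_action D A (pure c d)"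
    unfolding tensor_prod_pure[OF A]
    using A
    by (intro transformation_eqI)
      (simp_all add: tensor_action_pure sandwich_closed L.linear_end_closed L.linear_end_apply sandwich_linear
        prod_closed linear_end_value prod_assoc)
qed (use assms in auto)

text \<open>
  For a pure tensor, \<open>x \<mapsto> a(f x)b\<close> is visibly the composition of \<open>x \<mapsto> axb\<close> with \<open>f\<close>; both sides
  are linear in the tensor.
\<close>

lemma tensor_action_determined_by_identity:
  assumes "t \<in> carrier AxA" "f \<in> carrier L"
  shows "tensor_action D A t f = tensor_action D A t (identity_map A) \<otimes>\<^bsub>L\<^esub> f"
proof (rule AA.linear_on_tensor_eqI[where t = t])
  have \<delta>: "identity_map A \<in> carrier L"
    by (rule identity_map_in_linear_end[OF module_axioms])
  note eval = linear_on_comp[OF tensor_action_linear L.linear_end_evaluation_linear]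
  show "linear_on D AxA L (\<lambda>t. tensor_action D A t f)"
    by (rule eval[OF assms(2)])
  show "linear_on D AxA L (\<lambda>t. tensor_action D A t (identity_map A) \<otimes>\<^bsub>L\<^esub> f)"
    by (rule linear_on_comp[OF eval[OF \<delta>] L.product_linear(2)[OF assms(2)]])
  fix a b assume A: "a \<in> carrier A" "b \<in> carrier A"
  show "tensor_action D A (pure a b) f = tensor_action D A (pure a b) (identity_map A) \<otimes>\<^bsub>L\<^esub> f"
    unfolding tensor_action_pure[OF A]
    by (rule linear_end_eqI[of _ D A])
      (use A \<delta> assms(2) in \<open>simp_all add: sandwich_linear linear_end_rules identity_map_apply\<close>)
qed (rule assms(1))

lemma tensor_action_representation:
  "algebra_representation D (tensor_algebra D A) L (tensor_action D A)"
proof -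
  interpret T: associative_algebra D "tensor_algebra D A"
    by (rule tensor_algebra_associative)
  note act = linear_onD[OF tensor_action_linear]
  show ?thesis
    by unfold_locales (simp_all add: tensor_algebra_simps act tensor_action_prod)
qed

lemma tensor_action_identity_hom:
  "algebra_hom D (tensor_algebra D A) L (\<lambda>t. tensor_action D A t (identity_map A))"
proof -
  interpret T: associative_algebra D "tensor_algebra D A"
    by (rule tensor_algebra_associative)
  have \<delta>: "identity_map A \<in> carrier L"
    by (rule identity_map_in_linear_end[OF module_axioms])
  note eval = linear_onD[OF linear_on_comp[OF tensor_action_linear L.linear_end_evaluation_linear[OF \<delta>]]]
  have "tensor_action D A (tensor_prod D A s t) (identity_map A)
      = tensor_action D A s (identity_map A) \<otimes>\<^bsub>L\<^esub> tensor_action D A t (identity_map A)"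
    if "s \<in> carrier AxA" "t \<in> carrier AxA" for s t
    using that \<delta> eval(1)[OF that(2)]
    by (simp add: tensor_action_prod L.linear_end_apply flip: tensor_action_determined_by_identity)
  then show ?thesis
    by unfold_locales (simp_all add: tensor_algebra_simps eval)
qed

end

section \<open>Tensors as linear transformations\<close>

theorem theorem3p6p4:
  fixes D :: "('d, 'e) ring_scheme" and A :: "('d, 'a, 'm) module_scheme"
  assumes "associative_algebra D A"
  defines "T \<equiv> tensor_algebra D A"
    and "L \<equiv> linear_end D A"
    and "\<delta> \<equiv> identity_map A"
  shows "associative_algebra D T \<and>
    (\<forall>a\<in>carrier A. \<forall>b\<in>carrier A. \<forall>c\<in>carrier A. \<forall>d\<in>carrier A.
      pure_tensor D A A a b \<otimes>\<^bsub>T\<^esub> pure_tensor D A A c d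
        = pure_tensor D A A (a \<otimes>\<^bsub>A\<^esub> c) (d \<otimes>\<^bsub>A\<^esub> b)) \<and>
    algebra_representation D T L (tensor_action D A) \<and>
    (\<forall>a\<in>carrier A. \<forall>b\<in>carrier A. \<forall>f\<in>carrier L. \<forall>x\<in>carrier A.
      tensor_action D A (pure_tensor D A A a b) f x = (a \<otimes>\<^bsub>A\<^esub> f x) \<otimes>\<^bsub>A\<^esub> b) \<and>
    \<delta> \<in> carrier L \<and>
    algebra_hom D T L (\<lambda>t. tensor_action D A t \<delta>) \<and>
    (\<forall>a\<in>carrier A. \<forall>b\<in>carrier A. \<forall>x\<in>carrier A.
      tensor_action D A (pure_tensor D A A a b) \<delta> x = (a \<otimes>\<^bsub>A\<^esub> x) \<otimes>\<^bsub>A\<^esub> b) \<and>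
    (\<forall>t\<in>carrier T. \<forall>f\<in>carrier L.
      tensor_action D A t f = compose (carrier A) (tensor_action D A t \<delta>) f)"
proof -
  interpret associative_algebra D A by fact
  have \<delta>: "\<delta> \<in> carrier L"
    unfolding \<delta>_def L_def by (rule identity_map_in_linear_end[OF module_axioms])
  have pure: "tensor_action D A (pure_tensor D A A a b) f x = (a \<otimes>\<^bsub>A\<^esub> f x) \<otimes>\<^bsub>A\<^esub> b"
    if "a \<in> carrier A" "b \<in> carrier A" "f \<in> carrier L" "x \<in> carrier A" for a b f x
    using that by (simp add: tensor_action_pure L_def)
  show ?thesis
  proof (intro conjI ballI)
    show "associative_algebra D T"
      unfolding T_def by (rule tensor_algebra_associative)
    show "algebra_representation D T L (tensor_action D A)"
      unfolding T_def L_def by (rule tensor_action_representation)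
    show "algebra_hom D T L (\<lambda>t. tensor_action D A t \<delta>)"
      unfolding T_def L_def \<delta>_def by (rule tensor_action_identity_hom)
    fix a b assume A: "a \<in> carrier A" "b \<in> carrier A"
    show "pure_tensor D A A a b \<otimes>\<^bsub>T\<^esub> pure_tensor D A A c d = pure_tensor D A A (a \<otimes>\<^bsub>A\<^esub> c) (d \<otimes>\<^bsub>A\<^esub> b)"
      if "c \<in> carrier A" "d \<in> carrier A" for c d
      unfolding T_def tensor_algebra_simps by (rule tensor_prod_pure[OF A that])
    show "tensor_action D A (pure_tensor D A A a b) \<delta> x = (a \<otimes>\<^bsub>A\<^esub> x) \<otimes>\<^bsub>A\<^esub> b"
      if "x \<in> carrier A" for x
      using pure[OF A \<delta> that] that by (simp add: \<delta>_def identity_map_apply)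
  next
    fix t f assume "t \<in> carrier T" "f \<in> carrier L"
    then show "tensor_action D A t f = compose (carrier A) (tensor_action D A t \<delta>) f"
      using tensor_action_determined_by_identity[of t f]
      by (simp add: T_def L_def \<delta>_def tensor_algebra_simps linear_end_simps(2))
  qed (use \<delta> pure in auto)
qed

end
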